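(* In the isoperimetric control setting of the context, let $V(B)=\sup\{J(u):u\in\mathcal U,\ \mathcal C(u)=B\}$ for $B\in\mathbb R$ (with $V(B)=-\infty$ for $B\notin\operatorname{dom}V:=\{\mathcal C(u):u\in\mathcal U\}$), let $\ell(\mu)=\sup_{u\in\mathcal U}\{J(u)+\mu\,\mathcal C(u)\}$, and let $$\mathcal D(B):=\operatorname*{arg\,min}_{\mu\in\mathbb R}\{\ell(\mu)-\mu B\}.$$ Assume that $V$ is proper, concave, upper semicontinuous, and finite on $\operatorname{int}(\operatorname{dom}V)$. Suppose that the dual representation $V(B)=\inf_{\mu\in\mathbb R}\{\ell(\mu)-\mu B\}$ holds and that the infimum is attained at every $B\in\operatorname{int}(\operatorname{dom}V)$. Then, for every $B\in\operatorname{int}(\operatorname{dom}V)$, $$\partial^+V(B)=-\mathcal D(B),$$ i.e. $p\in\partial^+V(B)$ if and only if $-p\in\mathcal D(B)$. In particular, $V$ is differentiable at $B\in\operatorname{int}(\operatorname{dom}V)$ if and only if $\mathcal D(B)$ is a singleton $\{\mu\}$, and then $V'(B)=-\mu$; moreover $V$ is differentiable at Lebesgue-almost every $B\in\operatorname{int}(\operatorname{dom}V)$.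
   Context: Superdifferential. For concave $V$ and $B\in\operatorname{int}(\operatorname{dom}V)$, $\partial^+V(B):=\{p\in\mathbb R: V(\widetilde B)-V(B)\le p(\widetilde B-B)\text{ for all }\widetilde B\in\operatorname{dom}V\}$. "Proper" for the concave function $V$ means $V<+\infty$ everywhere and $V>-\infty$ somewhere. Setting. Fix $T>0$, $x_0\in\mathbb R^n$, $U\subset\mathbb R^m$, and $\mathcal U=\{u\in L^\infty(0,T;\mathbb R^m):u(t)\in U\text{ for a.e. }t\}$. The data $g:[0,T]\times\mathbb R^n\times\mathbb R^m\to\mathbb R^n$ and $f,h:[0,T]\times\mathbb R^n\times\mathbb R^m\to\mathbb R$ are measurable in $t$ and $C^1$ in $(x,u)$ for a.e. $t$; $g$ is Lipschitz in $x$ with a constant $L$ uniform in $u\in U$ and a.e. $t$; for some $c>0$, $\|g(t,x,u)\|\le c(1+\|x\|+\|u\|)$ and $|f(t,x,u)|,|h(t,x,u)|\le c(1+\|x\|^2+\|u\|^2)$ on $[0,T]\times\mathbb R^n\times U$; $\phi\in C^1(\mathbb R^n)$ with $|\phi(x)|\le c(1+\|x\|^2)$. For $u\in\mathcal U$, $x_u$ is the unique solution of $\dot x=g(t,x,u(t))$, $x(0)=x_0$; $J(u)=\int_0^Tf(t,x_u,u)\,dt+\phi(x_u(T))$ and $\mathcal C(u)=\int_0^Th(t,x_u,u)\,dt$ (both real-valued on $\mathcal U$). *)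

theory Defs
  imports "HOL-Analysis.Analysis"
begin

section \<open>Control systems\<close>

definition C1 :: "('a::real_normed_vector \<Rightarrow> 'b::real_normed_vector) \<Rightarrow> bool" where
  "C1 F \<longleftrightarrow> (\<exists>F' :: 'a \<Rightarrow> 'a \<Rightarrow>\<^sub>L 'b.
      (\<forall>z. (F has_derivative blinfun_apply (F' z)) (at z)) \<and> continuous_on UNIV F')"

text \<open>Controls are represented by functions rather than by classes modulo null sets; all
  quantities below depend only on the values of a control almost everywhere on \<open>[0,T]\<close>.\<close>

definition admissible :: "real \<Rightarrow> (real^'m) set \<Rightarrow> (real \<Rightarrow> real^'m) set" where
  "admissible T U = {u. u \<in> borel_measurable (lebesgue_on {0..T}) \<and>
      (\<exists>M. AE t in lebesgue_on {0..T}. norm (u t) \<le> M) \<and>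
      (AE t in lebesgue_on {0..T}. u t \<in> U)}"

text \<open>Solutions of \<open>x' = g(t,x,u)\<close>, \<open>x(0) = x\<^sub>0\<close> on \<open>[0,T]\<close> in the sense of
  Caratheodory, written in integral form (an absolutely continuous function satisfying the
  equation almost everywhere).\<close>

definition solves_control_ode ::
  "real \<Rightarrow> real^'n \<Rightarrow> (real \<Rightarrow> real^'n \<Rightarrow> real^'m \<Rightarrow> real^'n) \<Rightarrow> (real \<Rightarrow> real^'m) \<Rightarrow> (real \<Rightarrow> real^'n) \<Rightarrow> bool"
where
  "solves_control_ode T x0 g u x \<longleftrightarrow>
     integrable (lebesgue_on {0..T}) (\<lambda>s. g s (x s) (u s)) \<and>
     (\<forall>t\<in>{0..T}. x t = x0 + (LINT s|lebesgue_on {0..t}. g s (x s) (u s)))"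

text \<open>The solution is unique only as a function on \<open>[0,T]\<close>, hence \<open>extensional\<close>.\<close>

definition trajectory ::
  "real \<Rightarrow> real^'n \<Rightarrow> (real \<Rightarrow> real^'n \<Rightarrow> real^'m \<Rightarrow> real^'n) \<Rightarrow> (real \<Rightarrow> real^'m) \<Rightarrow> real \<Rightarrow> real^'n"
where
  "trajectory T x0 g u = (THE x. x \<in> extensional {0..T} \<and> solves_control_ode T x0 g u x)"

definition running_integral ::
  "real \<Rightarrow> (real \<Rightarrow> real^'n \<Rightarrow> real^'m \<Rightarrow> real) \<Rightarrow> (real \<Rightarrow> real^'n) \<Rightarrow> (real \<Rightarrow> real^'m) \<Rightarrow> real"
where
  "running_integral T f x u = (LINT t|lebesgue_on {0..T}. f t (x t) (u t))"


section \<open>Value function, dual function and dual minimizers\<close>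

text \<open>In \<open>ereal\<close> the supremum of the empty set is \<open>-\<infinity>\<close>, so the value function is \<open>-\<infinity>\<close>
  at every \<open>B\<close> that is not attained by \<open>C\<close>.\<close>

definition value_function :: "'u set \<Rightarrow> ('u \<Rightarrow> real) \<Rightarrow> ('u \<Rightarrow> real) \<Rightarrow> real \<Rightarrow> ereal" where
  "value_function \<U> J C B = (SUP u\<in>{u\<in>\<U>. C u = B}. ereal (J u))"

definition dual_function :: "'u set \<Rightarrow> ('u \<Rightarrow> real) \<Rightarrow> ('u \<Rightarrow> real) \<Rightarrow> real \<Rightarrow> ereal" where
  "dual_function \<U> J C \<mu> = (SUP u\<in>\<U>. ereal (J u + \<mu> * C u))"

definition dual_minimizers :: "(real \<Rightarrow> ereal) \<Rightarrow> real \<Rightarrow> real set" where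
  "dual_minimizers l B = {\<mu>. is_arg_min (\<lambda>\<nu>. l \<nu> - ereal (\<nu> * B)) (\<lambda>_. True) \<mu>}"


section \<open>Extended-real-valued concave functions\<close>

definition proper_concave_sense :: "('a \<Rightarrow> ereal) \<Rightarrow> bool" where
  "proper_concave_sense V \<longleftrightarrow> (\<forall>x. V x < \<infinity>) \<and> (\<exists>x. V x > -\<infinity>)"

text \<open>Concavity as convexity of the hypograph, which avoids \<open>\<infinity> - \<infinity>\<close>.\<close>

definition ereal_concave :: "('a::real_vector \<Rightarrow> ereal) \<Rightarrow> bool" where
  "ereal_concave V \<longleftrightarrow> convex {(x, r::real). ereal r \<le> V x}"

definition upper_semicontinuous :: "('a::topological_space \<Rightarrow> ereal) \<Rightarrow> bool" where
  "upper_semicontinuous V \<longleftrightarrow> (\<forall>a. open {x. V x < a})"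

definition superdifferential :: "real set \<Rightarrow> (real \<Rightarrow> ereal) \<Rightarrow> real \<Rightarrow> real set" where
  "superdifferential D V B = {p. \<forall>B'\<in>D. V B' - V B \<le> ereal (p * (B' - B))}"

end

theory Submission
  imports Defs
begin

text \<open>Everything rests on one equivalence: by the dual representation, \<open>\<mu>\<close> minimizes
  \<open>l \<nu> - \<nu> B\<close> iff \<open>l \<mu> \<le> V B + \<mu> B\<close>, that is, iff \<open>J u + \<mu> C u \<le> V B + \<mu> B\<close> for all
  controls \<open>u\<close>, and this says that \<open>-\<mu>\<close> is a supergradient of \<open>V\<close> at \<open>B\<close>. The rest is convex
  analysis on the line: a concave function is differentiable at an interior point iff its
  supergradient there is unique, and the open intervals between distinct supergradients at
  different points are disjoint, so only countably many points can carry more than one. The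
  control system enters only through the index set and the two functionals.\<close>

section \<open>Supergradients of real functions on the line\<close>

definition supergradients :: "real set \<Rightarrow> (real \<Rightarrow> real) \<Rightarrow> real \<Rightarrow> real set" where
  "supergradients S f x = {p. \<forall>y\<in>S. f y - f x \<le> p * (y - x)}"

text \<open>Subtracting the line of slope \<open>p\<close> makes \<open>x\<close> a local maximum,
  where the derivative \<open>d - p\<close> must vanish.\<close>

lemma supergradient_eq_derivative:
  assumes "x \<in> interior S" and "(f has_real_derivative d) (at x)" and "p \<in> supergradients S f x"
  shows "p = d"
proof -
  obtain e where e: "e > 0" "ball x e \<subseteq> S"
    using assms(1) by (auto simp: mem_interior)
  have "((\<lambda>y. f y - p * y) has_real_derivative d - p) (at x)"
    using assms(2) by (auto intro!: derivative_eq_intros)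
  moreover have "\<forall>y. \<bar>x - y\<bar> < e \<longrightarrow> f y - p * y \<le> f x - p * x"
  proof (intro allI impI)
    fix y assume "\<bar>x - y\<bar> < e"
    then have "y \<in> S" using e(2) by (auto simp: dist_real_def)
    then show "f y - p * y \<le> f x - p * x"
      using assms(3) by (auto simp: supergradients_def algebra_simps)
  qed
  ultimately have "d - p = 0" using DERIV_local_max e(1) by blast
  then show ?thesis by simp
qed

text \<open>If \<open>z\<close> lies above the line of slope \<open>q\<close> through the graph
  point at \<open>x\<close>, so does the whole chord from \<open>x\<close> to \<open>z\<close>, and
  a concave function lies above its chords.\<close>

lemma concave_on_line_bound:
  fixes f :: "real \<Rightarrow> real"
  assumes "concave_on S f" and "x \<in> S" and "z \<in> S" and "f z - f x > q * (z - x)"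
    and "0 \<le> t" and "t \<le> 1"
  shows "f (x + t * (z - x)) - f x \<ge> q * (t * (z - x))"
proof -
  have "f ((1 - t) *\<^sub>R x + t *\<^sub>R z) \<ge> (1 - t) * f x + t * f z"
    using assms concave_onD by blast
  moreover have "(1 - t) *\<^sub>R x + t *\<^sub>R z = x + t * (z - x)" by (simp add: algebra_simps)
  moreover have "t * (f z - f x) \<ge> t * (q * (z - x))"
    using assms by (intro mult_left_mono) auto
  ultimately show ?thesis by (simp add: algebra_simps)
qed

text \<open>The supergradient inequality bounds the difference quotient by \<open>p\<close> from
  above on the right and from below on the left; uniqueness yields the opposite bounds up to
  \<open>e/2\<close>.\<close>

lemma has_derivative_unique_supergradient:
  fixes f :: "real \<Rightarrow> real"
  assumes conc: "concave_on S f" and x: "x \<in> interior S" and p: "supergradients S f x = {p}"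
  shows "(f has_real_derivative p) (at x)"
proof -
  have xS: "x \<in> S" using x interior_subset by blast
  have le: "f y - f x \<le> p * (y - x)" if "y \<in> S" for y
    using p that by (auto simp: supergradients_def)
  have "((\<lambda>y. (f y - f x) / (y - x)) \<longlongrightarrow> p) (at x)"
  proof (rule tendstoI)
    fix e :: real assume e: "e > 0"
    txt \<open>Tilting the slope \<open>p\<close> by \<open>e/2\<close> either way destroys the supergradient property, and the
      violating point must lie on the side where the tilted line is lower.\<close>
    have "p - e/2 \<notin> supergradients S f x" "p + e/2 \<notin> supergradients S f x"
      using e p by auto
    then obtain r l where r: "r \<in> S" "f r - f x > (p - e/2) * (r - x)"
      and l: "l \<in> S" "f l - f x > (p + e/2) * (l - x)"
      by (auto simp: supergradients_def not_le)
    have "(p - e/2) * (r - x) < p * (r - x)" "(p + e/2) * (l - x) < p * (l - x)"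
      using le[OF r(1)] le[OF l(1)] r(2) l(2) by linarith+
    then have rx: "x < r" and lx: "l < x" using e by (auto simp: mult_less_cancel_right)
    \<comment> \<open>Membership in \<open>S\<close> allows the supergradient inequality at
      \<open>y\<close>; lying between \<open>l\<close> and \<open>r\<close> makes \<open>y\<close> a
      convex combination of \<open>x\<close> with one of them.\<close>
    have "eventually (\<lambda>y. y \<in> interior S \<inter> {l<..<r}) (at x)"
      using x rx lx by (intro eventually_at_in_open') auto
    moreover have "eventually (\<lambda>y. y \<noteq> x) (at x)" by (simp add: eventually_at_filter)
    ultimately show "eventually (\<lambda>y. dist ((f y - f x) / (y - x)) p < e) (at x)"
    proof eventually_elim
      case (elim y)
      then have yS: "y \<in> S" using interior_subset by blast
      show ?case
      proof (cases "y > x")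
        case True
        have "f (x + (y - x) / (r - x) * (r - x)) - f x \<ge> (p - e/2) * ((y - x) / (r - x) * (r - x))"
          using elim rx True by (intro concave_on_line_bound[OF conc xS r]) auto
        then have "f y - f x \<ge> (p - e/2) * (y - x)" using rx by simp
        then have "(f y - f x) / (y - x) \<ge> p - e/2" "(f y - f x) / (y - x) \<le> p"
          using le[OF yS] True by (simp_all add: field_simps)
        then show ?thesis using e by (simp add: dist_real_def)
      next
        case False
        then have yx: "y < x" using elim by simp
        have "f (x + (x - y) / (x - l) * (l - x)) - f x \<ge> (p + e/2) * ((x - y) / (x - l) * (l - x))"
          using elim lx yx by (intro concave_on_line_bound[OF conc xS l]) auto
        moreover have t: "(x - y) / (x - l) * (l - x) = y - x" using lx by (simp add: field_simps)
        ultimately have "f y - f x \<ge> (p + e/2) * (y - x)" unfolding t by simp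
        \<comment> \<open>Here \<open>y - x\<close> is negative, so dividing by it reverses both
          inequalities.\<close>
        then have "(f y - f x) / (y - x) \<le> p + e/2" "(f y - f x) / (y - x) \<ge> p"
          using le[OF yS] yx by (simp_all add: neg_divide_le_eq neg_le_divide_eq)
        then show ?thesis using e by (simp add: dist_real_def)
      qed
    qed
  qed
  then show ?thesis by (simp add: has_field_derivative_iff)
qed

text \<open>Differentiability only shows that there is at most one supergradient. Existence is
  assumed here and later comes from attainment of the dual infimum.\<close>

lemma concave_differentiable_iff_unique_supergradient:
  fixes f :: "real \<Rightarrow> real"
  assumes "concave_on S f" and "x \<in> interior S" and "supergradients S f x \<noteq> {}"
  shows "f differentiable (at x) \<longleftrightarrow> (\<exists>p. supergradients S f x = {p})"
  using assms supergradient_eq_derivative has_derivative_unique_supergradient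
  unfolding real_differentiable_def by blast

text \<open>Testing each supergradient at the other point and adding cancels the values of
  \<open>f\<close>.\<close>

lemma supergradients_antimono:
  assumes "x \<in> S" and "y \<in> S" and "x < y"
    and "p \<in> supergradients S f x" and "q \<in> supergradients S f y"
  shows "q \<le> p"
proof -
  have "f y - f x \<le> p * (y - x)" "f x - f y \<le> q * (x - y)"
    using assms by (auto simp: supergradients_def)
  then have "q * (y - x) \<le> p * (y - x)" by (simp add: algebra_simps)
  then show ?thesis using assms(3) by simp
qed

text \<open>A rational chosen strictly between two supergradients at each such point decreases
  strictly with the point, which gives an injection into the rationals.\<close>

lemma countable_nonunique_supergradients:
  "countable {x\<in>S. \<exists>p q. p < q \<and> p \<in> supergradients S f x \<and> q \<in> supergradients S f x}"
    (is "countable ?N")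
proof -
  define P where "P x s \<longleftrightarrow> s \<in> \<rat> \<and> (\<exists>p q. p < s \<and> s < q \<and>
      p \<in> supergradients S f x \<and> q \<in> supergradients S f x)" for x s
  have "\<forall>x\<in>?N. \<exists>s. P x s"
    unfolding P_def using Rats_dense_in_real by blast
  from bchoice[OF this] obtain s where "\<forall>x\<in>?N. P x (s x)" ..
  then have s: "s x \<in> \<rat> \<and> (\<exists>p q. p < s x \<and> s x < q \<and>
      p \<in> supergradients S f x \<and> q \<in> supergradients S f x)" if "x \<in> ?N" for x
    using that unfolding P_def by (rule bspec)
  have less: "s y < s x" if xy: "x \<in> ?N" "y \<in> ?N" "x < y" for x y
  proof -
    \<comment> \<open>The lower supergradient at \<open>x\<close> and the upper one at
      \<open>y\<close> give the chain \<open>s y < q \<le> p < s x\<close>.\<close>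
    obtain p where p: "p < s x" "p \<in> supergradients S f x" using s[OF xy(1)] by blast
    obtain q where q: "s y < q" "q \<in> supergradients S f y" using s[OF xy(2)] by blast
    have "q \<le> p" using supergradients_antimono[OF _ _ xy(3) p(2) q(2)] xy by blast
    then show ?thesis using p q by simp
  qed
  have "inj_on s ?N"
  proof (rule inj_onI)
    fix x y assume "x \<in> ?N" "y \<in> ?N" "s x = s y"
    then show "x = y" using less[of x y] less[of y x] by (cases x y rule: linorder_cases) auto
  qed
  moreover have "countable (s ` ?N)"
    using s by (intro countable_subset[OF _ countable_rat]) auto
  ultimately show ?thesis by (rule countable_image_inj_on[rotated])
qed

section \<open>The value function as a real concave function on its domain\<close>

lemma value_function_ge: "u \<in> \<U> \<Longrightarrow> ereal (J u) \<le> value_function \<U> J C (C u)"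
  unfolding value_function_def by (rule SUP_upper) auto

lemma value_function_le_iff:
  "value_function \<U> J C B \<le> a \<longleftrightarrow> (\<forall>u\<in>\<U>. C u = B \<longrightarrow> ereal (J u) \<le> a)"
  unfolding value_function_def by (auto simp: SUP_le_iff)

lemma mem_image_of_value_function: "value_function \<U> J C B \<noteq> -\<infinity> \<Longrightarrow> B \<in> C ` \<U>"
  using value_function_le_iff[of \<U> J C B "-\<infinity>"] by auto

text \<open>Any \<open>u\<close> with \<open>C u = B\<close> bounds the value from below by a real,
  and properness excludes \<infinity>. As \<open>real_of_ereal\<close> sends infinite values to 0,
  this is what makes it faithful on the domain.\<close>

lemma value_function_finite:
  assumes "proper_concave_sense (value_function \<U> J C)" and "B \<in> C ` \<U>"
  shows "ereal (real_of_ereal (value_function \<U> J C B)) = value_function \<U> J C B"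
proof -
  have "value_function \<U> J C B > -\<infinity>"
    using assms(2) value_function_ge[of _ \<U> J C] by (force intro: less_le_trans[of _ "ereal _"])
  moreover have "value_function \<U> J C B < \<infinity>"
    using assms(1) by (auto simp: proper_concave_sense_def)
  ultimately show ?thesis by (cases "value_function \<U> J C B") auto
qed

text \<open>Convexity of the hypograph, applied to two graph points, yields both the concavity
  inequality and the convexity of the domain.\<close>

lemma concave_on_real_value_function:
  assumes "proper_concave_sense (value_function \<U> J C)" and "ereal_concave (value_function \<U> J C)"
  shows "concave_on (C ` \<U>) (\<lambda>B. real_of_ereal (value_function \<U> J C B))"
proof -
  define v where "v B = real_of_ereal (value_function \<U> J C B)" for B
  have v: "value_function \<U> J C B = ereal (v B)" if "B \<in> C ` \<U>" for B
    using value_function_finite[OF assms(1) that] by (simp add: v_def)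
  have hyp: "ereal ((1 - t) * v x + t * v y) \<le> value_function \<U> J C ((1 - t) * x + t * y)"
    if "x \<in> C ` \<U>" "y \<in> C ` \<U>" "0 \<le> t" "t \<le> 1" for x y t
  proof -
    have "(1 - t) *\<^sub>R (x, v x) + t *\<^sub>R (y, v y) \<in> {(x, r). ereal r \<le> value_function \<U> J C x}"
      using assms(2) that v by (intro convexD_alt) (auto simp: ereal_concave_def)
    then show ?thesis by simp
  qed
  \<comment> \<open>The real lower bound \<open>hyp\<close> keeps the value at the combination above
    -\<infinity>, so its constraint set is nonempty.\<close>
  have mem: "(1 - t) * x + t * y \<in> C ` \<U>"
    if "x \<in> C ` \<U>" "y \<in> C ` \<U>" "0 \<le> t" "t \<le> 1" for x y t
    using hyp[OF that] by (intro mem_image_of_value_function[of _ J]) auto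
  have "concave_on (C ` \<U>) v"
    unfolding concave_on_iff
  proof (intro conjI ballI allI impI)
    show "convex (C ` \<U>)" using mem by (auto simp: convex_alt)
  next
    fix x y s t :: real
    assume A: "x \<in> C ` \<U>" "y \<in> C ` \<U>" "0 \<le> s" "0 \<le> t" "s + t = 1"
    then have s: "s = 1 - t" and "t \<le> 1" by auto
    then show "v (s *\<^sub>R x + t *\<^sub>R y) \<ge> s * v x + t * v y"
      using hyp[of x y t] mem[of x y t] v A(1,2,4) unfolding s by (metis ereal_less_eq(3) real_scaleR_def)
  qed
  then show ?thesis unfolding v_def .
qed

section \<open>Superdifferential and dual minimizers\<close>

lemma superdifferential_eq_supergradients:
  assumes "\<And>B. B \<in> S \<Longrightarrow> ereal (real_of_ereal (V B)) = V B" and "B \<in> S"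
  shows "superdifferential S V B = supergradients S (\<lambda>b. real_of_ereal (V b)) B"
proof -
  have "(V B' - V B \<le> ereal (p * (B' - B))) =
      (real_of_ereal (V B') - real_of_ereal (V B) \<le> p * (B' - B))" if "B' \<in> S" for B' p
    by (metis assms that ereal_less_eq(3) ereal_minus(1))
  then show ?thesis by (auto simp: superdifferential_def supergradients_def)
qed

lemma mem_dual_minimizers_iff:
  assumes "V = (INF \<nu>. l \<nu> - ereal (\<nu> * B))"
  shows "\<mu> \<in> dual_minimizers l B \<longleftrightarrow> l \<mu> - ereal (\<mu> * B) \<le> V"
  unfolding dual_minimizers_def is_arg_min_def assms
  by (auto simp: not_less le_INF_iff)

text \<open>Both memberships unfold into real inequalities indexed by the controls, and these
  coincide for \<open>p = -\<mu>\<close>.\<close>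

lemma superdifferential_value_function:
  fixes \<U> :: "'u set" and J C :: "'u \<Rightarrow> real"
  defines "V \<equiv> value_function \<U> J C" and "l \<equiv> dual_function \<U> J C"
  assumes fin: "\<bar>V B\<bar> \<noteq> \<infinity>" and dual: "V B = (INF \<mu>. l \<mu> - ereal (\<mu> * B))"
  shows "superdifferential (C ` \<U>) V B = uminus ` dual_minimizers l B"
proof -
  obtain b where b: "V B = ereal b" using fin by (cases "V B") auto
  have dm: "\<mu> \<in> dual_minimizers l B \<longleftrightarrow> (\<forall>u\<in>\<U>. J u + \<mu> * C u \<le> b + \<mu> * B)" for \<mu>
  proof -
    have "\<mu> \<in> dual_minimizers l B \<longleftrightarrow> l \<mu> \<le> ereal (b + \<mu> * B)"
      unfolding mem_dual_minimizers_iff[OF dual] b by (cases "l \<mu>") auto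
    then show ?thesis by (simp add: l_def dual_function_def SUP_le_iff)
  qed
  have sd: "p \<in> superdifferential (C ` \<U>) V B \<longleftrightarrow> (\<forall>u\<in>\<U>. J u - b \<le> p * (C u - B))" for p
  proof -
    \<comment> \<open>Since \<open>V B\<close> is a real \<open>b\<close>, it can change sides even
      when \<open>V B'\<close> is infinite.\<close>
    have "V B' - V B \<le> ereal r \<longleftrightarrow> V B' \<le> ereal (b + r)" for B' r
      unfolding b by (cases "V B'") auto
    then have "p \<in> superdifferential (C ` \<U>) V B \<longleftrightarrow>
        (\<forall>w\<in>\<U>. V (C w) \<le> ereal (b + p * (C w - B)))"
      by (simp add: superdifferential_def)
    \<comment> \<open>Bounding \<open>V (C w)\<close> means bounding \<open>J u\<close> for all
      \<open>u\<close> with \<open>C u = C w\<close>; over all \<open>w\<close> this ranges over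
      every control.\<close>
    also have "\<dots> \<longleftrightarrow> (\<forall>u\<in>\<U>. J u \<le> b + p * (C u - B))"
      by (auto simp: V_def value_function_le_iff)
    finally show ?thesis by (simp add: algebra_simps)
  qed
  have "p \<in> superdifferential (C ` \<U>) V B \<longleftrightarrow> - p \<in> dual_minimizers l B" for p
    unfolding sd dm by (simp add: algebra_simps)
  then show ?thesis by (force simp: image_iff)
qed

lemma dual_minimizers_nonempty:
  assumes "l \<mu> - ereal (\<mu> * B) = (INF \<nu>. l \<nu> - ereal (\<nu> * B))"
  shows "dual_minimizers l B \<noteq> {}"
  using mem_dual_minimizers_iff[OF refl, of \<mu> l B] assms by auto

lemma AE_not_in_countable: "countable (N :: real set) \<Longrightarrow> AE x in lebesgue. x \<notin> N"
  by (intro AE_not_in null_sets_completionI countable_imp_null_set_lborel)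

section \<open>Differentiability of the value function\<close>

lemma value_function_differentiability:
  fixes \<U> :: "'u set" and J C :: "'u \<Rightarrow> real"
  defines "V \<equiv> value_function \<U> J C" and "l \<equiv> dual_function \<U> J C"
  assumes proper: "proper_concave_sense V" and conc: "ereal_concave V"
    and dual: "\<And>B. B \<in> interior (C ` \<U>) \<Longrightarrow> V B = (INF \<mu>. l \<mu> - ereal (\<mu> * B))"
    and att: "\<And>B. B \<in> interior (C ` \<U>) \<Longrightarrow>
      \<exists>\<mu>. l \<mu> - ereal (\<mu> * B) = (INF \<nu>. l \<nu> - ereal (\<nu> * B))"
  shows "(\<forall>B\<in>interior (C ` \<U>).
      superdifferential (C ` \<U>) V B = uminus ` dual_minimizers l B \<and>
      ((\<lambda>b. real_of_ereal (V b)) differentiable (at B) \<longleftrightarrow> (\<exists>\<mu>. dual_minimizers l B = {\<mu>})) \<and>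
      (\<forall>\<mu>. dual_minimizers l B = {\<mu>} \<longrightarrow>
        ((\<lambda>b. real_of_ereal (V b)) has_real_derivative - \<mu>) (at B))) \<and>
    (AE B in lebesgue. B \<in> interior (C ` \<U>) \<longrightarrow> (\<lambda>b. real_of_ereal (V b)) differentiable (at B))"
proof -
  let ?S = "C ` \<U>" and ?v = "\<lambda>b. real_of_ereal (V b)"
  have fin: "ereal (?v B) = V B" if "B \<in> ?S" for B
    using value_function_finite proper that unfolding V_def by blast
  have conc': "concave_on ?S ?v"
    using concave_on_real_value_function proper conc unfolding V_def by blast
  have int: "B \<in> ?S" if "B \<in> interior ?S" for B using that interior_subset by blast
  have sd: "superdifferential ?S V B = uminus ` dual_minimizers l B" if "B \<in> interior ?S" for B
  proof -
    have "\<bar>V B\<bar> \<noteq> \<infinity>" using fin[OF int[OF that]] by (cases "V B") auto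
    then show ?thesis
      using superdifferential_value_function[of \<U> J C B] dual[OF that] unfolding V_def l_def by simp
  qed
  have sg: "supergradients ?S ?v B = uminus ` dual_minimizers l B" if "B \<in> interior ?S" for B
    using superdifferential_eq_supergradients[OF fin int[OF that]] sd[OF that] by simp
  have ne: "supergradients ?S ?v B \<noteq> {}" if "B \<in> interior ?S" for B
    using att[OF that] dual_minimizers_nonempty sg[OF that] by blast
  \<comment> \<open>Negation is an involution, so uniqueness passes between supergradients and
    multipliers.\<close>
  have singleton: "(\<exists>p. uminus ` M = {p}) \<longleftrightarrow> (\<exists>\<mu>. M = {\<mu>})" for M :: "real set"
  proof
    assume "\<exists>p. uminus ` M = {p}"
    then obtain p where "uminus ` M = {p}" ..
    then have "uminus ` uminus ` M = uminus ` {p}" by simp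
    then show "\<exists>\<mu>. M = {\<mu>}" by (auto simp: image_image)
  qed auto
  have diff: "?v differentiable (at B) \<longleftrightarrow> (\<exists>p. supergradients ?S ?v B = {p})"
    if "B \<in> interior ?S" for B
    using concave_differentiable_iff_unique_supergradient[OF conc' that ne[OF that]] .
  have deriv: "(?v has_real_derivative - \<mu>) (at B)"
    if "B \<in> interior ?S" "dual_minimizers l B = {\<mu>}" for B \<mu>
    using has_derivative_unique_supergradient[OF conc' that(1)] sg[OF that(1)] that(2) by simp
  \<comment> \<open>The exceptional set is countable, hence null; off it, existence and trichotomy
    leave exactly one supergradient.\<close>
  have "AE B in lebesgue. B \<in> interior ?S \<longrightarrow> ?v differentiable (at B)"
    using AE_not_in_countable[OF countable_nonunique_supergradients[of ?S ?v]]
  proof eventually_elim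
    case (elim B)
    show ?case
    proof
      assume B: "B \<in> interior ?S"
      obtain p where p: "p \<in> supergradients ?S ?v B" using ne[OF B] by blast
      have "q = p" if "q \<in> supergradients ?S ?v B" for q
        using elim int[OF B] p that by (cases p q rule: linorder_cases) blast+
      then show "?v differentiable (at B)" unfolding diff[OF B] using p by blast
    qed
  qed
  then show ?thesis using sd diff sg singleton deriv by auto
qed

theorem theorem3p9:
  fixes T L c :: real and x0 :: "real^'n" and U :: "(real^'m) set"
    and g :: "real \<Rightarrow> real^'n \<Rightarrow> real^'m \<Rightarrow> real^'n"
    and f h :: "real \<Rightarrow> real^'n \<Rightarrow> real^'m \<Rightarrow> real"
    and \<phi> :: "real^'n \<Rightarrow> real"
  defines "\<U> \<equiv> admissible T U"
  defines "J \<equiv> (\<lambda>u. running_integral T f (trajectory T x0 g u) u + \<phi> (trajectory T x0 g u T))"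
  defines "C \<equiv> (\<lambda>u. running_integral T h (trajectory T x0 g u) u)"
  defines "domV \<equiv> C ` \<U>"
  defines "V \<equiv> value_function \<U> J C"
  defines "l \<equiv> dual_function \<U> J C"
  defines "D \<equiv> dual_minimizers l"
  assumes "T > 0"
    and "\<And>x u. (\<lambda>t. g t x u) \<in> borel_measurable (lebesgue_on {0..T})"
    and "\<And>x u. (\<lambda>t. f t x u) \<in> borel_measurable (lebesgue_on {0..T})"
    and "\<And>x u. (\<lambda>t. h t x u) \<in> borel_measurable (lebesgue_on {0..T})"
    and "AE t in lebesgue_on {0..T}. C1 (\<lambda>(x, u). g t x u)"
    and "AE t in lebesgue_on {0..T}. C1 (\<lambda>(x, u). f t x u)"
    and "AE t in lebesgue_on {0..T}. C1 (\<lambda>(x, u). h t x u)"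
    and "AE t in lebesgue_on {0..T}. \<forall>u\<in>U. L-lipschitz_on UNIV (\<lambda>x. g t x u)"
    and "c > 0"
    and "\<And>t x u. t \<in> {0..T} \<Longrightarrow> u \<in> U \<Longrightarrow> norm (g t x u) \<le> c * (1 + norm x + norm u)"
    and "\<And>t x u. t \<in> {0..T} \<Longrightarrow> u \<in> U \<Longrightarrow> \<bar>f t x u\<bar> \<le> c * (1 + (norm x)\<^sup>2 + (norm u)\<^sup>2)"
    and "\<And>t x u. t \<in> {0..T} \<Longrightarrow> u \<in> U \<Longrightarrow> \<bar>h t x u\<bar> \<le> c * (1 + (norm x)\<^sup>2 + (norm u)\<^sup>2)"
    and "C1 \<phi>"
    and "\<And>x. \<bar>\<phi> x\<bar> \<le> c * (1 + (norm x)\<^sup>2)"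
    and "proper_concave_sense V"
    and "ereal_concave V"
    and "upper_semicontinuous V"
    and "\<And>B. B \<in> interior domV \<Longrightarrow> \<bar>V B\<bar> \<noteq> \<infinity>"
    and "\<And>B. B \<in> interior domV \<Longrightarrow> V B = (INF \<mu>. l \<mu> - ereal (\<mu> * B))"
    and "\<And>B. B \<in> interior domV \<Longrightarrow>
           \<exists>\<mu>. l \<mu> - ereal (\<mu> * B) = (INF \<nu>. l \<nu> - ereal (\<nu> * B))"
  shows "(\<forall>B\<in>interior domV.
            superdifferential domV V B = uminus ` D B \<and>
            ((\<lambda>b. real_of_ereal (V b)) differentiable (at B) \<longleftrightarrow> (\<exists>\<mu>. D B = {\<mu>})) \<and>
            (\<forall>\<mu>. D B = {\<mu>} \<longrightarrow> ((\<lambda>b. real_of_ereal (V b)) has_real_derivative - \<mu>) (at B))) \<and>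
         (AE B in lebesgue. B \<in> interior domV \<longrightarrow>
            (\<lambda>b. real_of_ereal (V b)) differentiable (at B))"
  \<comment> \<open>With \<open>\<U>\<close>, \<open>J\<close> and \<open>C\<close> kept folded, the
    goal is an instance of the abstract result.\<close>
  unfolding D_def l_def V_def domV_def
  by (rule value_function_differentiability) (use assms in blast)+

end
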